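(* Let $n\ge 2$, let $B^n\subset\mathbb{R}^n$ be the open unit ball centered at the origin, and let $E=\{e\}$ be a singleton with $e\in\partial B^n$. If $f:\bar B^n\to\mathbb{C}$ is continuous, then the broken ray transform of $f$ (with set of tomography $E$) uniquely determines the integral of $f$ over any circle contained in $\bar B^n$ that is centered at the origin and whose plane (the two-dimensional linear subspace containing it) contains $e$. That is, if $f,g:\bar B^n\to\mathbb{C}$ are continuous and have the same broken ray transform, then $\int_C f\,\mathrm{d}s=\int_C g\,\mathrm{d}s$ for every such circle $C$. In particular, if $n=2$, the integral of $f$ is determined over any circle centered at the origin contained in $\bar B^2$.
   Context: The boundary $\partial B^n$ is the disjoint union of the set of tomography $E$ and the reflecting part $R=\partial B^n\setminus E$. A broken ray is a unit speed curve $\gamma:[0,L]\to\bar B^n$ of finite length $L$ which is a straight line (geodesic) in the interior of the ball, has both endpoints on $E$, and reflects at other boundary points according to the usual reflection law: at a reflection point with outer unit normal $\nu$, the incoming direction $v_i$ and outgoing direction $v_o$ satisfy $v_o=v_i-2\langle\nu,v_i\rangle\nu$. A broken ray must reflect whenever it hits $R$; when it hits $E$ it may either reflect or stop. The broken ray transform of a continuous function $f$ is the function on the set of all broken rays given by $\gamma\mapsto\int_0^L f(\gamma(t))\,\mathrm{d}t$. *)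

theory Defs
  imports "HOL-Analysis.Analysis"
begin

section \<open>Broken rays in the closed unit ball\<close>

definition reflect :: "'a::euclidean_space \<Rightarrow> 'a \<Rightarrow> 'a" where
  "reflect \<nu> v = v - (2 * (\<nu> \<bullet> v)) *\<^sub>R \<nu>"

text \<open>
  The curve meets the boundary exactly at the times \<open>\<tau> 0 < \<dots> < \<tau> N\<close>: it stops at the last of
  them and reflects at all intermediate ones, whether or not they are mapped into \<open>E\<close>; hence it
  reflects whenever it hits the complement of \<open>E\<close>. The outer unit normal of the unit ball at a
  boundary point is that point itself. Requiring the pieces to run through the open ball excludes
  curves that glide along the boundary. The values of \<open>\<gamma>\<close> outside \<open>{0..L}\<close> are irrelevant.
\<close>
definition broken_rays :: "'a::euclidean_space set \<Rightarrow> (real \<times> (real \<Rightarrow> 'a)) set" where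
  "broken_rays E = {(L, \<gamma>). \<gamma> ` {0..L} \<subseteq> cball 0 1 \<and> \<gamma> 0 \<in> E \<and> \<gamma> L \<in> E \<and>
     (\<exists>(N::nat) \<tau> v. 0 < N \<and> \<tau> 0 = 0 \<and> \<tau> N = L \<and>
        (\<forall>i\<le>N. \<gamma> (\<tau> i) \<in> sphere 0 1) \<and>
        (\<forall>i<N. \<tau> i < \<tau> (Suc i) \<and> norm (v i) = 1 \<and>
           (\<forall>t\<in>{\<tau> i..\<tau> (Suc i)}. \<gamma> t = \<gamma> (\<tau> i) + (t - \<tau> i) *\<^sub>R v i) \<and>
           (\<forall>t\<in>{\<tau> i<..<\<tau> (Suc i)}. \<gamma> t \<in> ball 0 1)) \<and>
        (\<forall>i. Suc i < N \<longrightarrow> v (Suc i) = reflect (\<gamma> (\<tau> (Suc i))) (v i)))}"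

definition broken_ray_transform ::
    "'a::euclidean_space set \<Rightarrow> ('a \<Rightarrow> complex) \<Rightarrow> real \<times> (real \<Rightarrow> 'a) \<Rightarrow> complex" where
  "broken_ray_transform E f = (\<lambda>(L, \<gamma>)\<in>broken_rays E. integral {0..L} (\<lambda>t. f (\<gamma> t)))"


section \<open>Circles centered at the origin and integration along them\<close>

definition circle_in :: "'a::euclidean_space set \<Rightarrow> real \<Rightarrow> 'a set" where
  "circle_in P r = {x \<in> P. norm x = r}"

definition circle_frame :: "'a::euclidean_space set \<Rightarrow> real \<Rightarrow> 'a \<Rightarrow> 'a \<Rightarrow> bool" where
  "circle_frame C r u w \<longleftrightarrow>
     0 < r \<and> norm u = 1 \<and> norm w = 1 \<and> u \<bullet> w = 0 \<and> C = circle_in (span {u, w}) r"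

definition circle_param :: "real \<Rightarrow> 'a::euclidean_space \<Rightarrow> 'a \<Rightarrow> real \<Rightarrow> 'a" where
  "circle_param r u w \<theta> = r *\<^sub>R (cos \<theta> *\<^sub>R u + sin \<theta> *\<^sub>R w)"

text \<open>
  The parametrization has speed \<open>r\<close>, so the arc length element is \<open>r d\<theta>\<close>. The value does not depend
  on the chosen frame: see \<open>circle_integral_eq\<close>; a frame exists by \<open>circle_frame_exists\<close>.
\<close>
definition circle_integral :: "'a::euclidean_space set \<Rightarrow> ('a \<Rightarrow> complex) \<Rightarrow> complex" where
  "circle_integral C f = (SOME I. \<exists>r u w. circle_frame C r u w \<and>
     I = integral {0..2*pi} (\<lambda>\<theta>. r *\<^sub>R f (circle_param r u w \<theta>)))"

lemma circle_frame_exists: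
  fixes P :: "'a::euclidean_space set"
  assumes "subspace P" "dim P = 2" "0 < r"
  shows "\<exists>u w. circle_frame (circle_in P r) r u w"
proof -
  obtain B where B: "B \<subseteq> P" "pairwise orthogonal B" "\<And>x. x \<in> B \<Longrightarrow> norm x = 1"
      "independent B" "card B = dim P" "span B = P"
    using orthonormal_basis_subspace[OF assms(1)] by metis
  obtain u w where uw: "B = {u, w}" "u \<noteq> w"
    using B(5) assms(2) by (auto simp: card_2_iff)
  have "u \<bullet> w = 0"
    using B(2) uw by (auto simp: pairwise_def orthogonal_def)
  then show ?thesis
    using B uw assms(3) unfolding circle_frame_def by blast
qed

lemma in_span_pair: "x \<in> span {u, w} \<Longrightarrow> \<exists>a b. x = a *\<^sub>R u + b *\<^sub>R w"
  for x :: "'a::euclidean_space"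
  by (auto simp: span_insert span_singleton algebra_simps)

lemma circle_param_in:
  assumes "circle_frame C r u w"
  shows "circle_param r u w \<theta> \<in> C"
proof -
  have f: "norm u = 1" "norm w = 1" "u \<bullet> w = 0" "0 < r" "C = circle_in (span {u, w}) r"
    using assms by (auto simp: circle_frame_def)
  have "(norm (cos \<theta> *\<^sub>R u + sin \<theta> *\<^sub>R w))\<^sup>2 = (cos \<theta>)\<^sup>2 * (u \<bullet> u) + (sin \<theta>)\<^sup>2 * (w \<bullet> w)"
    using f(3) unfolding power2_norm_eq_inner
    by (simp add: inner_add_left inner_add_right inner_commute[of w u] power2_eq_square)
  also have "\<dots> = 1"
    using f(1,2) by (simp add: norm_eq_1)
  finally have "norm (cos \<theta> *\<^sub>R u + sin \<theta> *\<^sub>R w) = 1"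
    by (metis norm_ge_zero one_power2 power2_eq_imp_eq zero_le_one)
  moreover have "cos \<theta> *\<^sub>R u + sin \<theta> *\<^sub>R w \<in> span {u, w}"
    by (intro span_add span_scale span_base) auto
  ultimately show ?thesis
    using f(4,5) by (simp add: circle_in_def circle_param_def span_scale)
qed

lemma integral_periodic_shift:
  fixes h :: "real \<Rightarrow> complex"
  assumes c: "continuous_on UNIV h" and p: "\<And>x. h (x + 2*pi) = h x" and a: "0 \<le> a" "a < 2*pi"
  shows "integral {0..2*pi} (\<lambda>x. h (a + x)) = integral {0..2*pi} h"
proof -
  have i: "h integrable_on {x..y}" for x y
    by (rule integrable_continuous_real) (rule continuous_on_subset[OF c], simp)
  have "integral {0..2*pi} (\<lambda>x. h (a + x)) = integral {a..2*pi+a} h"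
    using integral_shift_Icc_real[of 0 "2*pi" h a] by (simp add: o_def)
  also have "\<dots> = integral {a..2*pi} h + integral {2*pi..2*pi+a} h"
    using a by (intro Henstock_Kurzweil_Integration.integral_combine[symmetric] i) auto
  also have "integral {2*pi..2*pi+a} h = integral {0..a} (\<lambda>x. h (2*pi + x))"
    using integral_shift_Icc_real[of 0 a h "2*pi"] by (simp add: o_def add.commute)
  also have "(\<lambda>x. h (2*pi + x)) = h"
    using p by (auto simp: add.commute)
  also have "integral {a..2*pi} h + integral {0..a} h = integral {0..2*pi} h"
    using a by (subst add.commute)
      (intro Henstock_Kurzweil_Integration.integral_combine i, auto)
  finally show ?thesis .
qed

lemma circle_integral_eq:
  fixes f :: "'a::euclidean_space \<Rightarrow> complex"
  assumes fr: "circle_frame C r u w" and cf: "continuous_on C f"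
  shows "circle_integral C f = integral {0..2*pi} (\<lambda>\<theta>. r *\<^sub>R f (circle_param r u w \<theta>))"
proof -
  have f: "norm u = 1" "norm w = 1" "u \<bullet> w = 0" "0 < r" "C = circle_in (span {u, w}) r"
    using fr by (auto simp: circle_frame_def)
  define h where "h \<theta> = r *\<^sub>R f (circle_param r u w \<theta>)" for \<theta>
  have "continuous_on UNIV (circle_param r u w)"
    unfolding circle_param_def by (intro continuous_intros)
  moreover have "range (circle_param r u w) \<subseteq> C"
    using circle_param_in[OF fr] by auto
  ultimately have ch: "continuous_on UNIV h"
    unfolding h_def by (intro continuous_on_scaleR continuous_on_const)
      (rule continuous_on_compose2[OF cf])
  have ph: "h (x + 2*pi) = h x" for x
    by (simp add: h_def circle_param_def)
  have "integral {0..2*pi} (\<lambda>\<theta>. r' *\<^sub>R f (circle_param r' u' w' \<theta>)) = integral {0..2*pi} h"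
    if fr': "circle_frame C r' u' w'" for r' u' w'
  proof -
    have f': "norm u' = 1" "norm w' = 1" "u' \<bullet> w' = 0" "0 < r'" "C = circle_in (span {u', w'}) r'"
      using fr' by (auto simp: circle_frame_def)
    have "r *\<^sub>R u \<in> C"
      using circle_param_in[OF fr, of 0] by (simp add: circle_param_def)
    then have r: "r' = r"
      using f(1,4) by (simp add: f'(5) circle_in_def)
    have "r *\<^sub>R u' \<in> span {u, w}" "r *\<^sub>R w' \<in> span {u, w}"
      using circle_param_in[OF fr', of 0] circle_param_in[OF fr', of "pi/2"] r f(5)
      by (auto simp: circle_param_def circle_in_def)
    then have "u' \<in> span {u, w}" "w' \<in> span {u, w}"
      using span_scale[of "r *\<^sub>R u'" "{u, w}" "1/r"] span_scale[of "r *\<^sub>R w'" "{u, w}" "1/r"] f(4)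
      by auto
    then obtain a b c d where ab: "u' = a *\<^sub>R u + b *\<^sub>R w" and cd: "w' = c *\<^sub>R u + d *\<^sub>R w"
      using in_span_pair by metis
    have uu: "u \<bullet> u = 1" "w \<bullet> w = 1" "w \<bullet> u = 0"
      using f by (auto simp: norm_eq_1 inner_commute)
    have "u' \<bullet> u' = 1" "w' \<bullet> w' = 1"
      using f' by (auto simp: norm_eq_1)
    then have e1: "a\<^sup>2 + b\<^sup>2 = 1" and e2: "c\<^sup>2 + d\<^sup>2 = 1" and e3: "a * c + b * d = 0"
      using uu f(3) f'(3) unfolding ab cd
      by (auto simp: inner_add_left inner_add_right power2_eq_square algebra_simps)
    define k where "k = a * d - b * c"
    have "a * k = (a\<^sup>2 + b\<^sup>2) * d - b * (a * c + b * d)"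
      "b * k = a * (a * c + b * d) - (a\<^sup>2 + b\<^sup>2) * c"
      by (simp_all add: k_def algebra_simps power2_eq_square)
    then have k: "d = a * k" "c = - (b * k)"
      using e1 e3 by simp_all
    have "k\<^sup>2 = (a\<^sup>2 + b\<^sup>2) * (c\<^sup>2 + d\<^sup>2) - (a * c + b * d)\<^sup>2"
      by (simp add: k_def algebra_simps power2_eq_square)
    then have "k\<^sup>2 = 1"
      using e1 e2 e3 by simp
    then have k1: "k = 1 \<or> k = -1"
      by (simp add: power2_eq_1_iff)
    obtain \<alpha> where \<alpha>: "0 \<le> \<alpha>" "\<alpha> < 2*pi" "a = cos \<alpha>" "b = sin \<alpha>"
      using sincos_total_2pi[OF e1] by metis
    show ?thesis
      using k1
    proof
      assume k: "k = 1"
      have "r' *\<^sub>R f (circle_param r' u' w' \<theta>) = h (\<alpha> + \<theta>)" for \<theta>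
        using k \<open>d = a * k\<close> \<open>c = - (b * k)\<close> \<alpha>(3,4)
        by (simp add: h_def r circle_param_def ab cd cos_add sin_add algebra_simps)
      then show ?thesis
        using integral_periodic_shift[OF ch ph \<alpha>(1,2)] by simp
    next
      assume k: "k = -1"
      have "r' *\<^sub>R f (circle_param r' u' w' \<theta>) = h (\<alpha> - \<theta>)" for \<theta>
        using k \<open>d = a * k\<close> \<open>c = - (b * k)\<close> \<alpha>(3,4)
        by (simp add: h_def r circle_param_def ab cd cos_diff sin_diff algebra_simps)
      then have "integral {0..2*pi} (\<lambda>\<theta>. r' *\<^sub>R f (circle_param r' u' w' \<theta>))
          = integral {0..2*pi} (\<lambda>\<theta>. h (\<alpha> - \<theta>))"
        by simp
      also have "\<dots> = integral {-(2*pi)..0} (\<lambda>\<theta>. h (\<alpha> + \<theta>))"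
        using Henstock_Kurzweil_Integration.integral_reflect_real
          [of 0 "-(2*pi)" "\<lambda>\<theta>. h (\<alpha> + \<theta>)"] by simp
      also have "\<dots> = integral {0..2*pi} (\<lambda>\<theta>. h (\<alpha> + (\<theta> - 2*pi)))"
        using integral_shift_Icc_real[of 0 "2*pi" "\<lambda>\<theta>. h (\<alpha> + \<theta>)" "-(2*pi)"]
        by (simp add: o_def)
      also have "(\<lambda>\<theta>. h (\<alpha> + (\<theta> - 2*pi))) = (\<lambda>\<theta>. h (\<alpha> + \<theta>))"
      proof
        show "h (\<alpha> + (\<theta> - 2*pi)) = h (\<alpha> + \<theta>)" for \<theta>
          using ph[of "\<alpha> + (\<theta> - 2*pi)"] by (simp only: add.assoc diff_add_cancel)
      qed
      also have "integral {0..2*pi} (\<lambda>\<theta>. h (\<alpha> + \<theta>)) = integral {0..2*pi} h"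
        by (rule integral_periodic_shift[OF ch ph \<alpha>(1,2)])
      finally show ?thesis .
    qed
  qed
  note indep = this
  have "circle_integral C f = integral {0..2*pi} h"
    unfolding circle_integral_def
  proof (rule some_equality)
    show "\<exists>r u w. circle_frame C r u w \<and> integral {0..2*pi} h =
        integral {0..2*pi} (\<lambda>\<theta>. r *\<^sub>R f (circle_param r u w \<theta>))"
      using fr indep[OF fr] by metis
  next
    fix I
    assume "\<exists>r u w. circle_frame C r u w \<and>
        I = integral {0..2*pi} (\<lambda>\<theta>. r *\<^sub>R f (circle_param r u w \<theta>))"
    then show "I = integral {0..2*pi} h"
      using indep by metis
  qed
  then show ?thesis
    unfolding indep[OF fr] .
qed

end

theory Submission
  imports Defs
begin

text \<open>
  In the plane \<open>span {e, w}\<close>, the broken rays from \<open>e\<close> to \<open>e\<close> whose chords all subtend the angle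
  \<open>2 \<beta> = 2 pi k / N\<close> at the origin are star polygons. For \<open>k\<close> coprime to \<open>N\<close>, the \<open>N\<close> chords are the
  rotations of a single chord by the multiples of \<open>2 pi / N\<close>, so the transform of \<open>f\<close>, divided by \<open>N\<close>,
  is a Riemann sum for the average over all rotations. Letting \<open>N\<close> tend to infinity with
  \<open>pi k / N\<close> tending to an arbitrary \<open>\<beta>\<close>, the transform determines the integral over every chord of
  the angular average of \<open>f\<close>, that is, the Abel transform of the circle integrals, and the
  Abel transform is injective on continuous functions.
\<close>

section \<open>Injectivity of the Abel transform\<close>

lemma mult_one_minus_square_in_unit:
  fixes x u :: real
  assumes "x \<in> {0..1}" "u \<in> {-1..1}"
  shows "x * (1 - u\<^sup>2) \<in> {0..1}"
proof -
  have "u\<^sup>2 \<le> 1"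
    using assms(2) by (simp add: abs_square_le_1 abs_le_iff)
  then show ?thesis
    using assms(1) by (auto intro!: mult_le_one)
qed

lemma real_poly_approx:
  fixes B :: "real \<Rightarrow> real"
  assumes "continuous_on {0..1} B" "0 < \<epsilon>"
  obtains a :: "nat \<Rightarrow> real" and n where "\<And>x. x \<in> {0..1} \<Longrightarrow> \<bar>B x - (\<Sum>i\<le>n. a i * x ^ i)\<bar> < \<epsilon>"
proof -
  obtain p where p: "real_polynomial_function p" "\<And>x. x \<in> {0..1} \<Longrightarrow> \<bar>B x - p x\<bar> < \<epsilon>"
    using Stone_Weierstrass_real_polynomial_function[of "{0..1}" B \<epsilon>] assms by auto
  then show ?thesis
    using that unfolding real_polynomial_function_iff_sum by blast
qed

section \<open>Wallis integrals\<close>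

text \<open>The function \<open>u * (1 - u\<^sup>2) ^ Suc n\<close> vanishes at both ends of the
  interval, and its derivative is a combination of the two integrands.\<close>

lemma integral_one_minus_square_power_Suc:
  "integral {-1..1} (\<lambda>u::real. (1 - u\<^sup>2) ^ Suc n)
    = (2 * real n + 2) / (2 * real n + 3) * integral {-1..1} (\<lambda>u. (1 - u\<^sup>2) ^ n)"
proof -
  define I where "I m = integral {-1..1} (\<lambda>u::real. (1 - u\<^sup>2) ^ m)" for m
  have I: "((\<lambda>u::real. (1 - u\<^sup>2) ^ m) has_integral I m) {-1..1}" for m
    unfolding I_def by (intro integrable_integral integrable_continuous_real continuous_intros)
  have 1: "((\<lambda>u. (2 * real n + 3) * (1 - u\<^sup>2) ^ Suc n - (2 * real n + 2) * (1 - u\<^sup>2) ^ n) has_integral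
      (1 * (1 - 1\<^sup>2) ^ Suc n - (- 1) * (1 - (- 1)\<^sup>2) ^ Suc n)) {-1..1::real}"
  proof (rule fundamental_theorem_of_calculus)
    fix u :: real
    have "((\<lambda>u. u * (1 - u\<^sup>2) ^ Suc n) has_field_derivative
        (1 - u\<^sup>2) ^ Suc n + u * (real (Suc n) * (1 - u\<^sup>2) ^ n * (- (2 * u)))) (at u within {-1..1})"
      by (auto intro!: derivative_eq_intros simp del: power_Suc)
    moreover have "(1 - u\<^sup>2) ^ Suc n + u * (real (Suc n) * (1 - u\<^sup>2) ^ n * (- (2 * u)))
        = (2 * real n + 3) * (1 - u\<^sup>2) ^ Suc n - (2 * real n + 2) * (1 - u\<^sup>2) ^ n"
      by (simp add: algebra_simps power2_eq_square)
    ultimately show "((\<lambda>u. u * (1 - u\<^sup>2) ^ Suc n) has_vector_derivative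
        (2 * real n + 3) * (1 - u\<^sup>2) ^ Suc n - (2 * real n + 2) * (1 - u\<^sup>2) ^ n) (at u within {-1..1})"
      by (simp only: has_real_derivative_iff_has_vector_derivative)
  qed simp
  have 2: "((\<lambda>u. (2 * real n + 3) * (1 - u\<^sup>2) ^ Suc n - (2 * real n + 2) * (1 - u\<^sup>2) ^ n) has_integral
      (2 * real n + 3) * I (Suc n) - (2 * real n + 2) * I n) {-1..1::real}"
    by (intro has_integral_diff has_integral_mult_right I)
  have "(2 * real n + 3) * I (Suc n) - (2 * real n + 2) * I n = 0"
    using has_integral_unique[OF 1 2] by simp
  then show ?thesis
    unfolding I_def[symmetric] by (simp add: field_simps)
qed

text \<open>The same argument with \<open>sin x * cos x ^ Suc n\<close>, which vanishes at 0 and at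
  pi/2.\<close>

lemma integral_cos_power_Suc_Suc:
  "integral {0..pi/2} (\<lambda>x. cos x ^ Suc (Suc n))
    = (real n + 1) / (real n + 2) * integral {0..pi/2} (\<lambda>x. cos x ^ n)"
proof -
  define I where "I m = integral {0..pi/2} (\<lambda>x. cos x ^ m)" for m
  have I: "((\<lambda>x. cos x ^ m) has_integral I m) {0..pi/2}" for m
    unfolding I_def by (intro integrable_integral integrable_continuous_real continuous_intros)
  have 1: "((\<lambda>x. (real n + 2) * cos x ^ Suc (Suc n) - (real n + 1) * cos x ^ n) has_integral
      (sin (pi/2) * cos (pi/2) ^ Suc n - sin 0 * cos 0 ^ Suc n)) {0..pi/2}"
  proof (rule fundamental_theorem_of_calculus)
    fix x :: real
    have "((\<lambda>x. sin x * cos x ^ Suc n) has_field_derivative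
        cos x * cos x ^ Suc n + sin x * (real (Suc n) * cos x ^ n * (- sin x))) (at x within {0..pi/2})"
      by (auto intro!: derivative_eq_intros simp del: power_Suc)
    moreover have "cos x * cos x ^ Suc n + sin x * (real (Suc n) * cos x ^ n * (- sin x))
        = cos x ^ Suc (Suc n) - (real n + 1) * cos x ^ n * (sin x)\<^sup>2"
      by (simp add: algebra_simps power2_eq_square)
    moreover have "\<dots> = (real n + 2) * cos x ^ Suc (Suc n) - (real n + 1) * cos x ^ n"
      unfolding sin_squared_eq by (simp add: algebra_simps power2_eq_square)
    ultimately show "((\<lambda>x. sin x * cos x ^ Suc n) has_vector_derivative
        (real n + 2) * cos x ^ Suc (Suc n) - (real n + 1) * cos x ^ n) (at x within {0..pi/2})"
      by (simp only: has_real_derivative_iff_has_vector_derivative)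
  qed simp
  have 2: "((\<lambda>x. (real n + 2) * cos x ^ Suc (Suc n) - (real n + 1) * cos x ^ n) has_integral
      (real n + 2) * I (Suc (Suc n)) - (real n + 1) * I n) {0..pi/2}"
    by (intro has_integral_diff has_integral_mult_right I)
  have "(real n + 2) * I (Suc (Suc n)) - (real n + 1) * I n = 0"
    using has_integral_unique[OF 1 2] by simp
  then show ?thesis
    unfolding I_def[symmetric] by (simp add: field_simps)
qed

text \<open>In the product of the two recursions the odd factors 2n + 3 cancel, leaving (n + 1) / (n
  + 2); this is why the product has a simple closed form although neither factor does.\<close>

lemma wallis_product:
  "integral {-1..1} (\<lambda>u::real. (1 - u\<^sup>2) ^ n) * integral {0..pi/2} (\<lambda>x. cos x ^ (2 * n + 2))
    = pi / (2 * (real n + 1))"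
proof (induction n)
  case 0
  show ?case
    using integral_cos_power_Suc_Suc[of 0] by (simp add: numeral_2_eq_2)
next
  case (Suc n)
  have *: "2 * Suc n + 2 = Suc (Suc (2 * n + 2))"
    by simp
  have "integral {-1..1} (\<lambda>u::real. (1 - u\<^sup>2) ^ Suc n) * integral {0..pi/2} (\<lambda>x. cos x ^ (2 * Suc n + 2))
     = (2 * real n + 2) / (2 * real n + 3) * ((real (2 * n + 2) + 1) / (real (2 * n + 2) + 2)) *
     (pi / (2 * (real n + 1)))"
    unfolding * integral_one_minus_square_power_Suc integral_cos_power_Suc_Suc Suc[symmetric]
    by (simp add: mult_ac)
  also have "\<dots> = pi / (2 * (real (Suc n) + 1))"
    by (simp add: divide_simps)
  finally show ?case .
qed

section \<open>The Abel operator on polynomials, then on continuous functions\<close>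

text \<open>
  Composing the Abel operator \<open>B \<mapsto> \<integral> B (x (1 - u\<^sup>2)) du\<close> with \<open>q \<mapsto> \<integral> cos\<^sup>2 \<phi> q (z cos\<^sup>2 \<phi>) d\<phi>\<close>
  multiplies \<open>x ^ i\<close> by \<open>pi / (2 (i + 1))\<close>, hence is, up to a constant, averaging over \<open>{0..z}\<close>.
\<close>
lemma abel_poly_bound:
  fixes a :: "nat \<Rightarrow> real"
  assumes bd: "\<And>x. x \<in> {0..<1} \<Longrightarrow> \<bar>integral {-1..1} (\<lambda>u. \<Sum>i\<le>n. a i * (x * (1 - u\<^sup>2)) ^ i)\<bar> \<le> \<delta>"
    and z: "z \<in> {0..<1}"
  shows "\<bar>integral {0..z} (\<lambda>x. \<Sum>i\<le>n. a i * x ^ i)\<bar> \<le> \<delta>"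
proof -
  have \<delta>: "0 \<le> \<delta>"
    using bd[of 0] by auto
  define c where "c i = integral {-1..1} (\<lambda>u::real. (1 - u\<^sup>2) ^ i)" for i :: nat
  define c' where "c' i = integral {0..pi/2} (\<lambda>x. cos x ^ (2 * i + 2))" for i :: nat
  have cc: "c i * c' i = pi / (2 * (real i + 1))" for i
    unfolding c_def c'_def by (rule wallis_product)
  have "((\<lambda>u::real. (1 - u\<^sup>2) ^ i) has_integral c i) {-1..1}" for i
    unfolding c_def by (intro integrable_integral integrable_continuous_real continuous_intros)
  then have "((\<lambda>u. \<Sum>i\<le>n. (a i * x ^ i) * (1 - u\<^sup>2) ^ i) has_integral (\<Sum>i\<le>n. a i * x ^ i * c i)) {-1..1}" for x
    by (intro has_integral_sum has_integral_mult_right) auto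
  then have T: "integral {-1..1} (\<lambda>u. \<Sum>i\<le>n. a i * (x * (1 - u\<^sup>2)) ^ i) = (\<Sum>i\<le>n. a i * x ^ i * c i)" for x
    by (intro integral_unique) (simp add: power_mult_distrib mult_ac)
  have "((\<lambda>x. cos x ^ (2 * i + 2)) has_integral c' i) {0..pi/2}" for i
    unfolding c'_def by (intro integrable_integral integrable_continuous_real continuous_intros)
  then have "((\<lambda>x. \<Sum>i\<le>n. (a i * z ^ i * c i) * cos x ^ (2 * i + 2)) has_integral
      (\<Sum>i\<le>n. a i * z ^ i * c i * c' i)) {0..pi/2}"
    by (intro has_integral_sum has_integral_mult_right) auto
  moreover have "(\<Sum>i\<le>n. (a i * z ^ i * c i) * cos x ^ (2 * i + 2))
      = (cos x)\<^sup>2 * (\<Sum>i\<le>n. a i * (z * (cos x)\<^sup>2) ^ i * c i)" for x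
    by (simp add: sum_distrib_left power_mult_distrib power_add power_mult power2_eq_square mult_ac)
  ultimately have S: "((\<lambda>x. (cos x)\<^sup>2 * (\<Sum>i\<le>n. a i * (z * (cos x)\<^sup>2) ^ i * c i)) has_integral
      (\<Sum>i\<le>n. a i * z ^ i * c i * c' i)) {0..pi/2}"
    by simp
  \<comment> \<open>By \<open>T\<close> the integrand is a squared cosine times the Abel integral of
    the polynomial at \<open>z * (cos x)\<^sup>2\<close>, a point of [0,1), where \<open>bd\<close>
    applies. The resulting bound depends neither on n nor on the coefficients.\<close>
  have "norm (\<Sum>i\<le>n. a i * z ^ i * c i * c' i) \<le> \<delta> * measure lborel {0..pi/2}"
  proof (rule has_integral_bound_real[OF _ _ S])
    show "0 \<le> \<delta>"
      by (rule \<delta>)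
    show "norm ((cos x)\<^sup>2 * (\<Sum>i\<le>n. a i * (z * (cos x)\<^sup>2) ^ i * c i)) \<le> \<delta>"
      if "x \<in> {0..pi/2} - {}" for x
    proof -
      have c1: "0 \<le> (cos x)\<^sup>2" "(cos x)\<^sup>2 \<le> 1"
        by (auto simp: abs_square_le_1)
      then have "z * (cos x)\<^sup>2 \<in> {0..<1}"
        using z mult_left_le[of "(cos x)\<^sup>2" z] by auto
      then have "\<bar>\<Sum>i\<le>n. a i * (z * (cos x)\<^sup>2) ^ i * c i\<bar> \<le> \<delta>"
        using bd T by metis
      then show ?thesis
        using c1 mult_mono[of "(cos x)\<^sup>2" 1 "\<bar>\<Sum>i\<le>n. a i * (z * (cos x)\<^sup>2) ^ i * c i\<bar>" \<delta>]
        by (simp add: abs_mult)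
    qed
  qed auto
  then have 1: "\<bar>\<Sum>i\<le>n. a i * z ^ i * c i * c' i\<bar> \<le> \<delta> * (pi / 2)"
    by simp
  have "((\<lambda>x. a i * x ^ i) has_integral a i * (z ^ Suc i / (real i + 1))) {0..z}" for i
  proof (rule has_integral_mult_right)
    have "((\<lambda>x. x ^ i) has_integral (z ^ Suc i / (real i + 1) - 0 ^ Suc i / (real i + 1))) {0..z}"
    proof (rule fundamental_theorem_of_calculus)
      show "((\<lambda>x. x ^ Suc i / (real i + 1)) has_vector_derivative x ^ i) (at x within {0..z})" for x
        unfolding has_real_derivative_iff_has_vector_derivative[symmetric]
        by (auto intro!: derivative_eq_intros simp: divide_simps add.commute simp del: power_Suc)
    qed (use z in auto)
    then show "((\<lambda>x. x ^ i) has_integral (z ^ Suc i / (real i + 1))) {0..z}"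
      by simp
  qed
  then have "((\<lambda>x. \<Sum>i\<le>n. a i * x ^ i) has_integral (\<Sum>i\<le>n. a i * (z ^ Suc i / (real i + 1)))) {0..z}"
    by (intro has_integral_sum) auto
  then have "integral {0..z} (\<lambda>x. \<Sum>i\<le>n. a i * x ^ i) = (\<Sum>i\<le>n. a i * (z ^ Suc i / (real i + 1)))"
    by (rule integral_unique)
  \<comment> \<open>As \<open>c i * c' i\<close> is pi / (2 (i + 1)), the factor 2 z / pi restores
    the coefficient of the primitive.\<close>
  also have "\<dots> = (\<Sum>i\<le>n. a i * z ^ i * c i * c' i) * (2 * z / pi)"
    unfolding sum_distrib_right mult.assoc cc by (intro sum.cong) (auto simp: field_simps)
  finally have eq: "integral {0..z} (\<lambda>x. \<Sum>i\<le>n. a i * x ^ i)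
      = (\<Sum>i\<le>n. a i * z ^ i * c i * c' i) * (2 * z / pi)" .
  have "\<bar>integral {0..z} (\<lambda>x. \<Sum>i\<le>n. a i * x ^ i)\<bar> \<le> \<delta> * (pi / 2) * (2 * z / pi)"
    unfolding eq abs_mult using z \<delta> by (intro mult_mono 1) auto
  also have "\<dots> \<le> \<delta>"
    using z \<delta> by (simp add: mult_left_le)
  finally show ?thesis .
qed

text \<open>Replacing B by a uniformly close polynomial changes the Abel integrals by at most twice
  the error, and \<open>abel_poly_bound\<close> carries this over to the primitive with a constant
  independent of the degree. Hence the primitive of B vanishes on [0,1), and so does its derivative
  B.\<close>

lemma abel_injective_real:
  fixes B :: "real \<Rightarrow> real"
  assumes cB: "continuous_on {0..1} B"
    and 0: "\<And>x. x \<in> {0..<1} \<Longrightarrow> integral {-1..1} (\<lambda>u. B (x * (1 - u\<^sup>2))) = 0"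
    and y: "y \<in> {0..<1}"
  shows "B y = 0"
proof -
  have int0: "integral {0..z} B = 0" if z: "z \<in> {0..<1}" for z
  proof (rule ccontr)
    assume nz: "integral {0..z} B \<noteq> 0"
    \<comment> \<open>The primitive of p contributes at most 2 \<epsilon> and the passage from p to
      B another \<epsilon>, which is less than the supposed 4 \<epsilon>.\<close>
    define \<epsilon> where "\<epsilon> = \<bar>integral {0..z} B\<bar> / 4"
    have \<epsilon>: "0 < \<epsilon>"
      using nz by (simp add: \<epsilon>_def)
    obtain a n where an: "\<And>x. x \<in> {0..1} \<Longrightarrow> \<bar>B x - (\<Sum>i\<le>n. a i * x ^ i)\<bar> < \<epsilon>"
      using real_poly_approx[OF cB \<epsilon>] by blast
    define p where "p x = (\<Sum>i\<le>n. a i * x ^ i)" for x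
    have cp: "continuous_on S p" for S
      unfolding p_def by (intro continuous_intros)
    have ap: "\<bar>B x - p x\<bar> \<le> \<epsilon>" if "x \<in> {0..1}" for x
      using an[OF that] by (simp add: p_def)
    have "\<bar>integral {-1..1} (\<lambda>u. p (x * (1 - u\<^sup>2)))\<bar> \<le> 2 * \<epsilon>" if x: "x \<in> {0..<1}" for x
    proof -
      have r: "x * (1 - u\<^sup>2) \<in> {0..1}" if "u \<in> {-1..1}" for u
      using mult_one_minus_square_in_unit[of x u] that x by auto
      have i1: "(\<lambda>u. B (x * (1 - u\<^sup>2))) integrable_on {-1..1}"
        by (intro integrable_continuous_real continuous_on_compose2[OF cB] continuous_intros) (use r in auto)
      have i2: "(\<lambda>u. p (x * (1 - u\<^sup>2))) integrable_on {-1..1}"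
        by (intro integrable_continuous_real continuous_on_compose2[OF cp[of UNIV]] continuous_intros) auto
      have "integral {-1..1} (\<lambda>u. p (x * (1 - u\<^sup>2)))
          = - integral {-1..1} (\<lambda>u. B (x * (1 - u\<^sup>2)) - p (x * (1 - u\<^sup>2)))"
        using 0[OF x] integral_diff[OF i1 i2] by simp
      also have "norm \<dots> \<le> \<epsilon> * (1 - (-1))"
        unfolding norm_minus_cancel
        by (rule integral_bound) (use r ap in \<open>auto intro!: continuous_intros continuous_on_compose2[OF cB] continuous_on_compose2[OF cp[of UNIV]]\<close>)
      finally show ?thesis by (simp add: mult.commute)
    qed
    then have "\<bar>integral {0..z} p\<bar> \<le> 2 * \<epsilon>"
      using abel_poly_bound[where a=a and n=n and \<delta>="2*\<epsilon>" and z=z] z unfolding p_def by blast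
    moreover have "\<bar>integral {0..z} B - integral {0..z} p\<bar> \<le> \<epsilon>"
    proof -
      have i: "B integrable_on {0..z}" "p integrable_on {0..z}"
        using z by (auto intro!: integrable_continuous_real cp continuous_on_subset[OF cB])
      have "integral {0..z} B - integral {0..z} p = integral {0..z} (\<lambda>x. B x - p x)"
        by (rule integral_diff[OF i, symmetric])
      also have "norm \<dots> \<le> \<epsilon> * (z - 0)"
        by (rule integral_bound) (use z ap in \<open>auto intro!: continuous_intros continuous_on_subset[OF cB] cp\<close>)
      also have "\<dots> \<le> \<epsilon>"
        using z \<epsilon> by (simp add: mult_left_le)
      finally show ?thesis by simp
    qed
    ultimately show False
      using \<epsilon> unfolding \<epsilon>_def by linarith
  qed
  \<comment> \<open>A point strictly between y and 1: the derivative at y, one-sided if y = 0, is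
    taken within a nondegenerate interval on which the primitive vanishes.\<close>
  define b where "b = (y + 1) / 2"
  have b: "y < b" "b < 1" "0 < b"
    using y by (auto simp: b_def)
  have "((\<lambda>x. integral {0..x} B) has_vector_derivative B y) (at y within {0..b})"
    by (rule integral_has_vector_derivative) (use b y in \<open>auto intro: continuous_on_subset[OF cB]\<close>)
  moreover have "((\<lambda>x. integral {0..x} B) has_vector_derivative 0) (at y within {0..b})"
    by (rule has_vector_derivative_transform[of _ _ _ "\<lambda>x. 0"]) (use b y int0 in auto)
  ultimately show ?thesis
    using vector_derivative_unique_within_closed_interval[of 0 b y] b y by auto
qed

lemma abel_injective:
  fixes B :: "real \<Rightarrow> complex"
  assumes cB: "continuous_on {0..1} B"
    and 0: "\<And>x. x \<in> {0..<1} \<Longrightarrow> integral {-1..1} (\<lambda>u. B (x * (1 - u\<^sup>2))) = 0"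
    and y: "y \<in> {0..<1}"
  shows "B y = 0"
proof -
  have i: "((\<lambda>u. B (x * (1 - u\<^sup>2))) has_integral 0) {-1..1}" if x: "x \<in> {0..<1}" for x
  proof -
    have r: "x * (1 - u\<^sup>2) \<in> {0..1}" if "u \<in> {-1..1}" for u
      using mult_one_minus_square_in_unit[of x u] that x by auto
    have "(\<lambda>u. B (x * (1 - u\<^sup>2))) integrable_on {-1..1}"
      by (intro integrable_continuous_real continuous_on_compose2[OF cB] continuous_intros) (use r in auto)
    then show ?thesis
      using 0[OF x] by (metis integrable_integral)
  qed
  have "Re (B y) = 0"
    by (rule abel_injective_real[OF _ _ y])
      (use cB has_integral_Re[OF i] in \<open>auto intro!: continuous_intros integral_unique\<close>)
  moreover have "Im (B y) = 0"
    by (rule abel_injective_real[OF _ _ y])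
      (use cB has_integral_Im[OF i] in \<open>auto intro!: continuous_intros integral_unique\<close>)
  ultimately show ?thesis
    by (simp add: complex_eq_iff)
qed

section \<open>Riemann sums over star polygons\<close>

lemma bij_betw_mult_mod:
  fixes N k :: nat
  assumes "coprime k N" "0 < N"
  shows "bij_betw (\<lambda>j. j * k mod N) {..<N} {..<N}"
proof -
  have "inj_on (\<lambda>j. j * k mod N) {..<N}"
  proof (rule linorder_inj_onI)
    fix i j assume ij: "i < j" "i \<in> {..<N}" "j \<in> {..<N}"
    show "i * k mod N \<noteq> j * k mod N"
    proof
      assume "i * k mod N = j * k mod N"
      then have "N dvd (j - i) * k"
        using ij mod_eq_dvd_iff_nat[of "i * k" "j * k" N] by (simp add: diff_mult_distrib)
      then have "N dvd j - i"
        using assms(1) by (simp add: coprime_commute coprime_dvd_mult_left_iff)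
      then show False
        using ij by (auto dest!: dvd_imp_le)
    qed
  qed auto
  moreover have "(\<lambda>j. j * k mod N) ` {..<N} \<subseteq> {..<N}"
    using assms(2) by auto
  ultimately show ?thesis
    by (simp add: bij_betw_def endo_inj_surj)
qed

lemma periodic_shift_multiple:
  fixes F :: "real \<Rightarrow> 'b"
  assumes "\<And>x. F (x + 2 * pi) = F x"
  shows "F (x + 2 * pi * real m) = F x"
proof (induction m)
  case (Suc m)
  have "x + 2 * pi * real (Suc m) = (x + 2 * pi * real m) + 2 * pi"
    by (simp add: algebra_simps)
  then show ?case
    using assms Suc by metis
qed simp

text \<open>A star polygon visits the vertices of the regular N-gon in another order: full turns
  drop out by periodicity, and multiplication by k permutes the residues modulo N.\<close>

lemma sum_star_vertices:
  fixes F :: "real \<Rightarrow> complex" and N k :: nat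
  assumes F: "\<And>x. F (x + 2 * pi) = F x" and "coprime k N" "0 < N"
  shows "(\<Sum>j<N. F (a + 2 * pi * real (j * k) / real N)) = (\<Sum>j<N. F (a + 2 * pi * real j / real N))"
proof -
  have "F (a + 2 * pi * real (j * k) / real N) = F (a + 2 * pi * real (j * k mod N) / real N)" for j
  proof -
    have "real (j * k) = real N * real (j * k div N) + real (j * k mod N)"
      by (metis of_nat_add of_nat_mult mult_div_mod_eq)
    then have "a + 2 * pi * real (j * k) / real N
        = (a + 2 * pi * real (j * k mod N) / real N) + 2 * pi * real (j * k div N)"
      using assms(3) by (simp add: field_simps)
    then show ?thesis
      using periodic_shift_multiple[of F, OF F] by metis
  qed
  then show ?thesis
    using sum.reindex_bij_betw[OF bij_betw_mult_mod[OF assms(2,3)],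
        of "\<lambda>j. F (a + 2 * pi * real j / real N)"] by simp
qed

lemma has_integral_consecutive:
  fixes F :: "real \<Rightarrow> 'b::banach"
  assumes "0 \<le> l"
    and "\<And>i. i < n \<Longrightarrow> (F has_integral I i) {real i * l..real (Suc i) * l}"
  shows "(F has_integral (\<Sum>i<n. I i)) {0..real n * l}"
  using assms(2)
proof (induction n)
  case (Suc n)
  have "(F has_integral (\<Sum>i<n. I i) + I n) {0..real (Suc n) * l}"
    by (rule has_integral_combine[of _ "real n * l"])
      (use assms(1) Suc in \<open>auto intro!: mult_right_mono\<close>)
  then show ?case by simp
qed auto

text \<open>On each of the N cells F deviates by at most \<epsilon> from its value at the left
  endpoint, and the cells have total length p.\<close>

lemma riemann_sum_bound:
  fixes F :: "real \<Rightarrow> 'b::banach"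
  assumes cF: "continuous_on UNIV F" and N: "0 < N" and p: "0 \<le> p"
    and F: "\<And>x y. \<bar>x - y\<bar> \<le> p / real N \<Longrightarrow> norm (F x - F y) \<le> \<epsilon>"
  shows "norm (integral {0..p} F - (p / real N) *\<^sub>R (\<Sum>j<N. F (p * real j / real N))) \<le> p * \<epsilon>"
proof -
  define l where "l = p / real N"
  have l: "0 \<le> l" "real N * l = p" "\<And>j. p * real j / real N = real j * l"
    using p N by (auto simp: l_def)
  define D where "D j = integral {real j * l..real (Suc j) * l} (\<lambda>x. F x - F (real j * l))" for j
  have "norm (D j) \<le> \<epsilon> * (real (Suc j) * l - real j * l)" for j
    unfolding D_def
  proof (rule integral_bound)
    show "continuous_on {real j * l..real (Suc j) * l} (\<lambda>x. F x - F (real j * l))"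
      by (intro continuous_intros continuous_on_subset[OF cF]) auto
    show "norm (F x - F (real j * l)) \<le> \<epsilon>" if "x \<in> {real j * l..real (Suc j) * l}" for x
      by (rule F) (use that in \<open>auto simp: l_def[symmetric] algebra_simps\<close>)
  qed (use l(1) in \<open>simp add: algebra_simps\<close>)
  then have D: "norm (D j) \<le> \<epsilon> * l" for j
    by (simp add: algebra_simps)
  have "(F has_integral D j + l *\<^sub>R F (real j * l)) {real j * l..real (Suc j) * l}" for j
  proof -
    have 1: "((\<lambda>x. F x - F (real j * l)) has_integral D j) {real j * l..real (Suc j) * l}"
      unfolding D_def
      by (intro integrable_integral integrable_continuous_real continuous_intros continuous_on_subset[OF cF]) auto
    have 2: "((\<lambda>x. F (real j * l)) has_integral l *\<^sub>R F (real j * l)) {real j * l..real (Suc j) * l}"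
      using has_integral_const_real[of "F (real j * l)" "real j * l" "real (Suc j) * l"] l(1)
      by (simp add: algebra_simps)
    show ?thesis
      using has_integral_add[OF 1 2] by simp
  qed
  then have "(F has_integral (\<Sum>j<N. D j + l *\<^sub>R F (real j * l))) {0..real N * l}"
    by (intro has_integral_consecutive l(1))
  then have "integral {0..p} F = (\<Sum>j<N. D j) + l *\<^sub>R (\<Sum>j<N. F (real j * l))"
    by (simp add: l(2) integral_unique sum.distrib scaleR_sum_right)
  then have "norm (integral {0..p} F - l *\<^sub>R (\<Sum>j<N. F (real j * l))) = norm (\<Sum>j<N. D j)"
    by simp
  also have "\<dots> \<le> (\<Sum>j<N. \<epsilon> * l)"
    by (rule sum_norm_le) (rule D)
  also have "\<dots> = p * \<epsilon>"
    using l(2) by (simp add: mult_ac)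
  finally show ?thesis
    unfolding l(3) l_def[symmetric] .
qed

lemma abs_sin_diff_le: "\<bar>sin x - sin y\<bar> \<le> \<bar>x - y\<bar>"
  for x y :: real
proof -
  have "\<bar>sin x - sin y\<bar> = 2 * (\<bar>sin ((x - y) / 2)\<bar> * \<bar>cos ((x + y) / 2)\<bar>)"
    by (simp add: sin_diff_sin abs_mult)
  also have "\<dots> \<le> 2 * (\<bar>(x - y) / 2\<bar> * 1)"
    by (intro mult_left_mono mult_mono abs_sin_x_le_abs_x) auto
  finally show ?thesis by simp
qed

lemma abs_cos_diff_le: "\<bar>cos x - cos y\<bar> \<le> \<bar>x - y\<bar>"
  for x y :: real
  using abs_sin_diff_le[of "x + pi/2" "y + pi/2"] by (simp add: sin_add)

section \<open>Star polygons as broken rays\<close>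

lemma polar_coordinates:
  obtains \<alpha> where "0 \<le> \<alpha>" "\<alpha> < 2 * pi" "x = sqrt (x\<^sup>2 + y\<^sup>2) * cos \<alpha>" "y = sqrt (x\<^sup>2 + y\<^sup>2) * sin \<alpha>"
proof (cases "x = 0 \<and> y = 0")
  case True
  then show ?thesis
    using that[of 0] by simp
next
  case False
  define \<rho> where "\<rho> = sqrt (x\<^sup>2 + y\<^sup>2)"
  have "0 < x\<^sup>2 + y\<^sup>2"
    using False by (simp add: sum_power2_gt_zero_iff)
  then have \<rho>: "0 < \<rho>" "\<rho>\<^sup>2 = x\<^sup>2 + y\<^sup>2"
    by (simp_all add: \<rho>_def)
  then have "(x / \<rho>)\<^sup>2 + (y / \<rho>)\<^sup>2 = 1"
    using False by (simp add: power_divide flip: add_divide_distrib)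
  then obtain \<alpha> where \<alpha>: "0 \<le> \<alpha>" "\<alpha> < 2 * pi" "x / \<rho> = cos \<alpha>" "y / \<rho> = sin \<alpha>"
    using sincos_total_2pi by metis
  show ?thesis
    by (rule that[OF \<alpha>(1,2)]; unfold \<rho>_def[symmetric] \<alpha>(3,4)[symmetric]) (use \<rho>(1) in auto)
qed

text \<open>The point with coordinates (d, t) in the frame (e, w) turned by the angle \<phi>. For
  fixed d, varying t traces a line with normal direction \<phi> at signed distance d from the
  origin, and varying \<phi> traces a circle.\<close>

definition rotated_point :: "'a::euclidean_space \<Rightarrow> 'a \<Rightarrow> real \<Rightarrow> real \<Rightarrow> real \<Rightarrow> 'a" where
  "rotated_point e w \<phi> d t = (d * cos \<phi> - t * sin \<phi>) *\<^sub>R e + (d * sin \<phi> + t * cos \<phi>) *\<^sub>R w"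

lemma rotated_point_add:
  "rotated_point e w (\<phi> + \<alpha>) d t = rotated_point e w \<phi> (d * cos \<alpha> - t * sin \<alpha>) (d * sin \<alpha> + t * cos \<alpha>)"
  by (simp add: rotated_point_def cos_add sin_add algebra_simps)

lemma rotated_point_periodic: "rotated_point e w (\<phi> + 2 * pi) d t = rotated_point e w \<phi> d t"
  by (simp add: rotated_point_def)

lemma rotated_point_diff_scaleR:
  "rotated_point e w \<phi> a b - k *\<^sub>R rotated_point e w \<phi> c d
    = rotated_point e w \<phi> (a - k * c) (b - k * d)"
  by (simp add: rotated_point_def algebra_simps)

lemma continuous_on_rotated_point [continuous_intros]:
  fixes \<phi> d t :: "'b::t2_space \<Rightarrow> real"
  assumes "continuous_on S \<phi>" "continuous_on S d" "continuous_on S t"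
  shows "continuous_on S (\<lambda>x. rotated_point e w (\<phi> x) (d x) (t x))"
  unfolding rotated_point_def by (intro continuous_intros continuous_on_cos continuous_on_sin assms)

text \<open>Each coordinate of the difference consists of two products, all four at most
  \<open>\<bar>\<phi> - \<psi>\<bar>\<close>. The constant 4 times the mesh 2 pi / N is the origin
  of \<open>8 * pi / real N\<close> in \<open>star_polygon_bound\<close>.\<close>

lemma norm_rotated_point_diff_le:
  assumes "norm e = 1" "norm w = 1" "\<bar>d\<bar> \<le> 1" "\<bar>t\<bar> \<le> 1"
  shows "norm (rotated_point e w \<phi> d t - rotated_point e w \<psi> d t) \<le> 4 * \<bar>\<phi> - \<psi>\<bar>"
proof -
  have *: "\<bar>d * x\<bar> \<le> \<bar>\<phi> - \<psi>\<bar>" "\<bar>t * x\<bar> \<le> \<bar>\<phi> - \<psi>\<bar>" if "\<bar>x\<bar> \<le> \<bar>\<phi> - \<psi>\<bar>" for x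
    using that assms(3,4) mult_mono[of "\<bar>d\<bar>" 1 "\<bar>x\<bar>" "\<bar>\<phi> - \<psi>\<bar>"] mult_mono[of "\<bar>t\<bar>" 1 "\<bar>x\<bar>" "\<bar>\<phi> - \<psi>\<bar>"]
    by (auto simp: abs_mult)
  have "rotated_point e w \<phi> d t - rotated_point e w \<psi> d t
      = (d * (cos \<phi> - cos \<psi>) - t * (sin \<phi> - sin \<psi>)) *\<^sub>R e
        + (d * (sin \<phi> - sin \<psi>) + t * (cos \<phi> - cos \<psi>)) *\<^sub>R w"
    by (simp add: rotated_point_def algebra_simps)
  also have "norm \<dots> \<le> \<bar>d * (cos \<phi> - cos \<psi>) - t * (sin \<phi> - sin \<psi>)\<bar>
      + \<bar>d * (sin \<phi> - sin \<psi>) + t * (cos \<phi> - cos \<psi>)\<bar>"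
    using norm_triangle_ineq assms(1,2) by (metis norm_scaleR mult.right_neutral)
  also have "\<dots> \<le> 4 * \<bar>\<phi> - \<psi>\<bar>"
    using *[OF abs_sin_diff_le] *[OF abs_cos_diff_le]
      abs_triangle_ineq4[of "d * (cos \<phi> - cos \<psi>)" "t * (sin \<phi> - sin \<psi>)"]
      abs_triangle_ineq[of "d * (sin \<phi> - sin \<psi>)" "t * (cos \<phi> - cos \<psi>)"] by linarith
  finally show ?thesis .
qed

text \<open>For positive \<open>sin \<beta>\<close>, chord i has length
  \<open>2 * sin \<beta>\<close> and its midpoint at signed distance \<open>cos \<beta>\<close> in
  direction \<open>(2 * i + 1) * \<beta>\<close>; the last argument is the signed arc length from
  that midpoint. At a vertex the floor selects the chord that starts there.\<close>

definition star_ray :: "'a::euclidean_space \<Rightarrow> 'a \<Rightarrow> real \<Rightarrow> real \<Rightarrow> 'a" where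
  "star_ray e w \<beta> t = (let i = real_of_int \<lfloor>t / (2 * sin \<beta>)\<rfloor>
     in rotated_point e w ((2 * i + 1) * \<beta>) (cos \<beta>) (t - (2 * i + 1) * sin \<beta>))"

text \<open>Turning (cos \<beta>, - sin \<beta>) by \<beta> gives (1, 0). Together with the mirrored
  statement for the end of a chord, this makes consecutive chords meet at the boundary point of
  angle \<theta>.\<close>

lemma rotated_point_chord_start:
  "rotated_point e w (\<theta> + \<beta>) (cos \<beta>) (- sin \<beta>) = rotated_point e w \<theta> 1 0"
  using sin_cos_squared_add2[of \<beta>] by (simp add: rotated_point_add power2_eq_square mult.commute)

lemma rotated_point_chord_end:
  "rotated_point e w (\<theta> - \<beta>) (cos \<beta>) (sin \<beta>) = rotated_point e w \<theta> 1 0"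
  using rotated_point_chord_start[of e w \<theta> "-\<beta>"] by simp

lemma star_ray_chord:
  assumes s: "0 < sin \<beta>" and t: "t \<in> {real i * (2 * sin \<beta>)..real (Suc i) * (2 * sin \<beta>)}"
  shows "star_ray e w \<beta> t = rotated_point e w ((2 * real i + 1) * \<beta>) (cos \<beta>) (t - (2 * real i + 1) * sin \<beta>)"
proof (cases "t = real (Suc i) * (2 * sin \<beta>)")
  \<comment> \<open>Here the floor has already jumped to \<open>Suc i\<close>; the start of that
    chord is the end of chord i.\<close>
  case True
  then have "\<lfloor>t / (2 * sin \<beta>)\<rfloor> = int (Suc i)"
    using s by simp
  then have "star_ray e w \<beta> t = rotated_point e w (real (Suc i) * (2 * \<beta>) + \<beta>) (cos \<beta>) (- sin \<beta>)"
    unfolding star_ray_def True by (simp add: Let_def algebra_simps)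
  also have "\<dots> = rotated_point e w (real (Suc i) * (2 * \<beta>) - \<beta>) (cos \<beta>) (sin \<beta>)"
    unfolding rotated_point_chord_start rotated_point_chord_end ..
  finally show ?thesis
    unfolding True by (simp add: algebra_simps)
next
  case False
  then have "real i \<le> t / (2 * sin \<beta>)" "t / (2 * sin \<beta>) < real i + 1"
    using s t by (auto simp: field_simps)
  then have "\<lfloor>t / (2 * sin \<beta>)\<rfloor> = int i"
    by (intro floor_unique) auto
  then show ?thesis
    by (simp add: star_ray_def Let_def)
qed

lemma star_ray_vertex:
  assumes "0 < sin \<beta>"
  shows "star_ray e w \<beta> (real i * (2 * sin \<beta>)) = rotated_point e w (real i * (2 * \<beta>)) 1 0"
proof -
  have "star_ray e w \<beta> (real i * (2 * sin \<beta>))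
      = rotated_point e w (real i * (2 * \<beta>) + \<beta>) (cos \<beta>) (- sin \<beta>)"
    using assms by (subst star_ray_chord[where i = i]) (auto simp: algebra_simps)
  then show ?thesis
    by (simp only: rotated_point_chord_start)
qed

section \<open>Star polygons in the plane of an orthonormal pair\<close>

locale orthonormal_pair =
  fixes e w :: "'a::euclidean_space"
  assumes norm_e: "norm e = 1" and norm_w: "norm w = 1" and inner_e_w: "e \<bullet> w = 0"
begin

abbreviation "pt \<equiv> rotated_point e w"

lemma inner_rotated_point: "pt \<phi> a b \<bullet> pt \<phi> c d = a * c + b * d"
proof -
  have "e \<bullet> e = 1" "w \<bullet> w = 1" "w \<bullet> e = 0"
    using norm_e norm_w inner_e_w by (auto simp: norm_eq_1 inner_commute)
  then have "pt \<phi> a b \<bullet> pt \<phi> c d = (a * cos \<phi> - b * sin \<phi>) * (c * cos \<phi> - d * sin \<phi>)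
      + (a * sin \<phi> + b * cos \<phi>) * (c * sin \<phi> + d * cos \<phi>)"
    by (simp add: rotated_point_def inner_add_left inner_add_right inner_e_w)
  also have "\<dots> = (a * c + b * d) * ((sin \<phi>)\<^sup>2 + (cos \<phi>)\<^sup>2)"
    unfolding power2_eq_square by algebra
  also have "(sin \<phi>)\<^sup>2 + (cos \<phi>)\<^sup>2 = 1"
    by simp
  finally show ?thesis by simp
qed

lemma norm_rotated_point: "norm (pt \<phi> d t) = sqrt (d\<^sup>2 + t\<^sup>2)"
  by (simp add: norm_eq_sqrt_inner inner_rotated_point power2_eq_square)

text \<open>The N chords subtend the total angle 2 pi k, so the polygon closes up at e, and at every
  vertex the two chords are mirror images in the radius. If N and k have a common factor, the ray
  also meets e at intermediate times, where it may reflect.\<close>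

lemma star_ray_in_broken_rays:
  assumes s: "0 < sin \<beta>" and N: "0 < N" and cl: "real N * \<beta> = pi * real k"
  shows "(real N * (2 * sin \<beta>), star_ray e w \<beta>) \<in> broken_rays {e}"
proof -
  define \<tau> where "\<tau> i = real i * (2 * sin \<beta>)" for i :: nat
  define v where "v i = pt ((2 * real i + 1) * \<beta>) 0 1" for i :: nat
  have V: "star_ray e w \<beta> (\<tau> i) = pt (real i * (2 * \<beta>)) 1 0" for i
    unfolding \<tau>_def by (rule star_ray_vertex[OF s])
  have less: "\<tau> i < \<tau> (Suc i)" for i
    using s by (simp add: \<tau>_def algebra_simps)
  have chord: "star_ray e w \<beta> t = pt ((2 * real i + 1) * \<beta>) (cos \<beta>) (t - (2 * real i + 1) * sin \<beta>)"
    if "t \<in> {\<tau> i..\<tau> (Suc i)}" for t i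
    using star_ray_chord[OF s] that unfolding \<tau>_def by blast
  \<comment> \<open>Power of a point: the product of the distances to the two ends of the chord is 1
    minus the squared norm, so its sign decides between the open and the closed ball.\<close>
  have normsq: "(cos \<beta>)\<^sup>2 + (t - (2 * real i + 1) * sin \<beta>)\<^sup>2 = 1 - (t - \<tau> i) * (\<tau> (Suc i) - t)" for t i
    using cos_squared_eq[of \<beta>] by (simp add: \<tau>_def power2_eq_square algebra_simps)
  have ball: "star_ray e w \<beta> t \<in> ball 0 1" if "t \<in> {\<tau> i<..<\<tau> (Suc i)}" for t i
  proof -
    have t: "t \<in> {\<tau> i..\<tau> (Suc i)}"
      using that by auto
    have "0 < (t - \<tau> i) * (\<tau> (Suc i) - t)"
      using that by simp
    then show ?thesis
      by (simp add: chord[OF t] norm_rotated_point normsq)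
  qed
  have line: "star_ray e w \<beta> t = star_ray e w \<beta> (\<tau> i) + (t - \<tau> i) *\<^sub>R v i"
    if "t \<in> {\<tau> i..\<tau> (Suc i)}" for t i
  proof -
    have i: "\<tau> i \<in> {\<tau> i..\<tau> (Suc i)}"
      using less[of i] by simp
    show ?thesis
      unfolding chord[OF that] chord[OF i] by (simp add: v_def rotated_point_def algebra_simps)
  qed
  have refl: "v (Suc i) = reflect (star_ray e w \<beta> (\<tau> (Suc i))) (v i)" for i
  proof -
    \<comment> \<open>In the frame turned to the vertex the first coordinate of a velocity is its
      normal component: it changes from sin \<beta> to - sin \<beta>, while the tangential component
      cos \<beta> is kept.\<close>
    define \<theta> where "\<theta> = real (Suc i) * (2 * \<beta>)"
    have "v i = pt (\<theta> + - \<beta>) 0 1" "v (Suc i) = pt (\<theta> + \<beta>) 0 1"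
      by (simp_all add: v_def \<theta>_def algebra_simps)
    then have "v i = pt \<theta> (sin \<beta>) (cos \<beta>)" "v (Suc i) = pt \<theta> (- sin \<beta>) (cos \<beta>)"
      unfolding rotated_point_add by simp_all
    then show ?thesis
      unfolding V \<theta>_def[symmetric] reflect_def
      by (simp add: inner_rotated_point rotated_point_diff_scaleR)
  qed
  have sphere: "star_ray e w \<beta> (\<tau> i) \<in> sphere 0 1" for i
    unfolding V by (simp add: norm_rotated_point)
  have \<tau>0: "\<tau> 0 = 0"
    by (simp add: \<tau>_def)
  have start: "star_ray e w \<beta> 0 = e"
    using V[of 0] by (simp add: \<tau>_def rotated_point_def)
  have stop: "star_ray e w \<beta> (\<tau> N) = e"
  proof -
    have N\<beta>: "real N * (2 * \<beta>) = 0 + 2 * pi * real k"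
      using cl by simp
    have "star_ray e w \<beta> (\<tau> N) = pt 0 1 0"
      unfolding V N\<beta> by (rule periodic_shift_multiple) (rule rotated_point_periodic)
    then show ?thesis
      by (simp add: rotated_point_def)
  qed
  have "star_ray e w \<beta> t \<in> cball 0 1" if "t \<in> {0..\<tau> N}" for t
  proof -
    \<comment> \<open>At \<open>t = \<tau> N\<close> this index is N, one past the last chord; the
      chord formula covers that chord as well.\<close>
    define i where "i = nat \<lfloor>t / (2 * sin \<beta>)\<rfloor>"
    have "0 \<le> t / (2 * sin \<beta>)"
      using that s by simp
    then have "real i \<le> t / (2 * sin \<beta>)" "t / (2 * sin \<beta>) \<le> real (Suc i)"
      unfolding i_def by linarith+
    then have t: "t \<in> {\<tau> i..\<tau> (Suc i)}"
      using s by (auto simp: \<tau>_def field_simps)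
    then have "0 \<le> (t - \<tau> i) * (\<tau> (Suc i) - t)"
      by simp
    then show ?thesis
      by (simp add: chord[OF t] norm_rotated_point normsq)
  qed
  moreover have "norm (v i) = 1" for i
    by (simp add: v_def norm_rotated_point)
  ultimately have "(\<tau> N, star_ray e w \<beta>) \<in> broken_rays {e}"
    unfolding broken_rays_def mem_Collect_eq split_conv image_subset_iff
    using N start stop sphere less line ball refl \<tau>0 by blast
  then show ?thesis
    by (simp add: \<tau>_def)
qed

text \<open>Dividing the arc length from the midpoint by sin \<beta> maps every chord to [-1,1].
  With the sum inside the integral, each x gathers the points at relative position x on all N
  chords, which differ only by rotations.\<close>

lemma star_ray_has_integral:
  fixes f :: "'a \<Rightarrow> complex"
  assumes cf: "continuous_on (cball 0 1) f" and s: "0 < sin \<beta>"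
  shows "((\<lambda>t. f (star_ray e w \<beta> t)) has_integral
      (sin \<beta> *\<^sub>R integral {-1..1} (\<lambda>x. \<Sum>i<N. f (pt ((2 * real i + 1) * \<beta>) (cos \<beta>) (sin \<beta> * x)))))
      {0..real N * (2 * sin \<beta>)}"
proof -
  define G where "G i x = f (pt ((2 * real i + 1) * \<beta>) (cos \<beta>) (sin \<beta> * x))" for i :: nat and x
  have G: "(G i has_integral integral {-1..1} (G i)) {-1..1}" for i
  proof -
    have "pt \<phi> (cos \<beta>) (sin \<beta> * x) \<in> cball 0 1" if "x \<in> {-1..1}" for x \<phi>
    proof -
      have "x\<^sup>2 \<le> 1"
        using that by (simp add: abs_square_le_1 abs_le_iff)
      then have "(cos \<beta>)\<^sup>2 + (sin \<beta> * x)\<^sup>2 \<le> (cos \<beta>)\<^sup>2 + (sin \<beta>)\<^sup>2 * 1"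
        unfolding power_mult_distrib by (intro add_left_mono mult_left_mono) auto
      then show ?thesis
        by (simp add: norm_rotated_point)
    qed
    then show ?thesis
      unfolding G_def
      by (intro integrable_integral integrable_continuous_real continuous_on_compose2[OF cf]
          continuous_intros) auto
  qed
  have "((\<lambda>t. f (star_ray e w \<beta> t)) has_integral sin \<beta> *\<^sub>R integral {-1..1} (G i))
      {real i * (2 * sin \<beta>)..real (Suc i) * (2 * sin \<beta>)}" for i
  proof -
    have eq: "G i (inverse (sin \<beta>) *\<^sub>R t + - (2 * real i + 1)) = f (star_ray e w \<beta> t)"
      if "t \<in> {real i * (2 * sin \<beta>)..real (Suc i) * (2 * sin \<beta>)}" for t
    proof -
      have "sin \<beta> * (inverse (sin \<beta>) *\<^sub>R t + - (2 * real i + 1)) = t - (2 * real i + 1) * sin \<beta>"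
        using s by (simp add: field_simps)
      then show ?thesis
        unfolding G_def star_ray_chord[OF s that] by simp
    qed
    have "((\<lambda>t. G i (inverse (sin \<beta>) *\<^sub>R t + - (2 * real i + 1))) has_integral
        sin \<beta> *\<^sub>R integral {-1..1} (G i)) {real i * (2 * sin \<beta>)..real (Suc i) * (2 * sin \<beta>)}"
      using has_integral_affinity'[of "G i" "integral {-1..1} (G i)" "-1" 1 "inverse (sin \<beta>)" "- (2 * real i + 1)"] G s
      by (simp add: algebra_simps)
    then show ?thesis
      by (rule has_integral_eq[rotated]) (rule eq)
  qed
  then have "((\<lambda>t. f (star_ray e w \<beta> t)) has_integral (\<Sum>i<N. sin \<beta> *\<^sub>R integral {-1..1} (G i)))
      {0..real N * (2 * sin \<beta>)}"
    using s by (intro has_integral_consecutive) auto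
  moreover have "integral {-1..1} (\<lambda>x. \<Sum>i<N. G i x) = (\<Sum>i<N. integral {-1..1} (G i))"
    by (rule integral_unique, rule has_integral_sum) (use G in auto)
  ultimately show ?thesis
    by (simp add: scaleR_sum_right G_def)
qed

section \<open>The angular integral\<close>

lemma circle_param_eq: "circle_param r e w \<theta> = pt \<theta> r 0"
  by (simp add: circle_param_def rotated_point_def algebra_simps)

text \<open>The argument is \<open>y = 1 - \<rho>\<^sup>2\<close> for a circle of radius \<open>\<rho>\<close>: a chord with half-length \<open>s\<close> then
  meets the circles with \<open>y = s\<^sup>2 (1 - u\<^sup>2)\<close>, where \<open>u\<close> runs through \<open>{-1..1}\<close>.\<close>
definition angular_integral :: "('a \<Rightarrow> complex) \<Rightarrow> real \<Rightarrow> complex" where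
  "angular_integral f y = integral {0..2 * pi} (\<lambda>\<phi>. f (pt \<phi> (sqrt (1 - y)) 0))"

text \<open>In polar coordinates the point has radius \<open>sqrt (1 - y)\<close> and some angle
  \<alpha>, so the integrand is the defining one shifted by \<alpha>, and a shift preserves the
  integral over a period.\<close>

lemma angular_integral_rotated_point:
  assumes cf: "continuous_on (cball 0 1) f" and dt: "d\<^sup>2 + t\<^sup>2 = 1 - y" and y: "0 \<le> y"
  shows "integral {0..2 * pi} (\<lambda>\<phi>. f (pt (a + \<phi>) d t)) = angular_integral f y"
proof -
  define d' t' where "d' = d * cos a - t * sin a" and "t' = d * sin a + t * cos a"
  have "d'\<^sup>2 + t'\<^sup>2 = (d\<^sup>2 + t\<^sup>2) * ((sin a)\<^sup>2 + (cos a)\<^sup>2)"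
    unfolding d'_def t'_def power2_eq_square by algebra
  then have dt': "d'\<^sup>2 + t'\<^sup>2 = 1 - y"
    using dt by simp
  obtain \<alpha> where \<alpha>: "0 \<le> \<alpha>" "\<alpha> < 2 * pi" "d' = sqrt (1 - y) * cos \<alpha>" "t' = sqrt (1 - y) * sin \<alpha>"
    using polar_coordinates[of d' t'] unfolding dt' by metis
  have "0 \<le> 1 - y"
    unfolding dt[symmetric] by simp
  then have "continuous_on UNIV (\<lambda>\<phi>. f (pt \<phi> (sqrt (1 - y)) 0))"
    using y by (intro continuous_on_compose2[OF cf] continuous_intros) (auto simp: norm_rotated_point)
  then have "integral {0..2 * pi} (\<lambda>\<phi>. f (pt (\<alpha> + \<phi>) (sqrt (1 - y)) 0)) = angular_integral f y"
    unfolding angular_integral_def using \<alpha>(1,2)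
    by (intro integral_periodic_shift) (simp_all add: rotated_point_periodic)
  moreover have "pt (a + \<phi>) d t = pt (\<alpha> + \<phi>) (sqrt (1 - y)) 0" for \<phi>
    using rotated_point_add[of e w \<phi> a d t] rotated_point_add[of e w \<phi> \<alpha> "sqrt (1 - y)" 0] \<alpha>(3,4)
    by (simp add: add.commute d'_def t'_def)
  ultimately show ?thesis
    by simp
qed

lemma continuous_on_angular_integral:
  assumes cf: "continuous_on (cball 0 1) f"
  shows "continuous_on {0..1} (angular_integral f)"
proof -
  have "continuous_on ({0..1} \<times> cbox 0 (2 * pi)) (\<lambda>(y, \<phi>). f (pt \<phi> (sqrt (1 - y)) 0))"
    unfolding split_beta
    by (intro continuous_on_compose2[OF cf] continuous_intros) (auto simp: norm_rotated_point)
  then show ?thesis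
    unfolding angular_integral_def using integral_continuous_on_param by fastforce
qed

section \<open>From star polygons to all chords by a limit\<close>

text \<open>Up to \<open>\<epsilon>\<close>, the sum over the \<open>N\<close> chords of a star polygon is a Riemann sum of the angular integral.\<close>
lemma star_polygon_bound:
  assumes ch: "continuous_on (cball 0 1) h"
    and \<delta>: "\<And>x y. x \<in> cball 0 1 \<Longrightarrow> y \<in> cball 0 1 \<Longrightarrow> dist x y < \<delta> \<Longrightarrow> dist (h x) (h y) \<le> \<epsilon>"
    and N: "0 < N" "coprime k N" "8 * pi / real N < \<delta>"
    and \<beta>: "\<beta> = pi * real k / real N" "0 < sin \<beta>"
    and zero: "((\<lambda>t. h (star_ray e w \<beta> t)) has_integral 0) {0..real N * (2 * sin \<beta>)}"
  shows "norm (integral {-1..1} (\<lambda>u. angular_integral h ((sin \<beta>)\<^sup>2 * (1 - u\<^sup>2)))) \<le> 4 * pi * \<epsilon>"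
proof -
  define p where "p u \<phi> = pt \<phi> (cos \<beta>) (sin \<beta> * u)" for u \<phi>
  define S where "S u = (\<Sum>i<N. h (p u ((2 * real i + 1) * \<beta>)))" for u
  have rad: "(cos \<beta>)\<^sup>2 + (sin \<beta> * u)\<^sup>2 = 1 - (sin \<beta>)\<^sup>2 * (1 - u\<^sup>2)" for u
    using sin_cos_squared_add[of \<beta>] by (simp add: algebra_simps power_mult_distrib)
  have y01: "(sin \<beta>)\<^sup>2 * (1 - u\<^sup>2) \<in> {0..1}" if "u \<in> {-1..1}" for u
    using that by (intro mult_one_minus_square_in_unit) (auto simp: abs_square_le_1)
  have pb: "p u \<phi> \<in> cball 0 1" if "u \<in> {-1..1}" for u \<phi>
    using y01[OF that] by (simp add: p_def norm_rotated_point rad)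
  have cS: "continuous_on {-1..1} S"
    unfolding S_def
    by (intro continuous_on_sum continuous_on_compose2[OF ch]) (use pb in \<open>auto simp: p_def intro!: continuous_intros\<close>)
  have ca: "continuous_on {-1..1} (\<lambda>u. angular_integral h ((sin \<beta>)\<^sup>2 * (1 - u\<^sup>2)))"
    by (intro continuous_on_compose2[OF continuous_on_angular_integral[OF ch]] continuous_intros)
      (use y01 in auto)
  have "sin \<beta> *\<^sub>R integral {-1..1} S = 0"
    using has_integral_unique[OF star_ray_has_integral[OF ch \<beta>(2), of N] zero]
    by (simp add: S_def[abs_def] p_def)
  then have S0: "integral {-1..1} S = 0"
    using \<beta>(2) by simp
  have riemann: "norm (angular_integral h ((sin \<beta>)\<^sup>2 * (1 - u\<^sup>2)) - (2 * pi / real N) *\<^sub>R S u) \<le> 2 * pi * \<epsilon>"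
    if u: "u \<in> {-1..1}" for u
  proof -
    define F where "F \<phi> = h (p u (\<beta> + \<phi>))" for \<phi>
    have per: "h (p u (x + 2 * pi)) = h (p u x)" for x
      by (simp add: p_def rotated_point_periodic)
    \<comment> \<open>The midpoint directions advance in steps of 2 pi k / N; as k is coprime to N,
      these are the equally spaced angles in another order.\<close>
    have "(2 * real i + 1) * \<beta> = \<beta> + 2 * pi * real (i * k) / real N" for i
      using N(1) by (simp add: \<beta>(1) field_simps)
    then have "S u = (\<Sum>i<N. h (p u (\<beta> + 2 * pi * real (i * k) / real N)))"
      unfolding S_def by simp
    also have "\<dots> = (\<Sum>i<N. h (p u (\<beta> + 2 * pi * real i / real N)))"
      by (rule sum_star_vertices[where F = "\<lambda>x. h (p u x)", OF per N(2,1)])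
    finally have S: "S u = (\<Sum>i<N. F (2 * pi * real i / real N))"
      by (simp add: F_def)
    have cF: "continuous_on UNIV F"
      unfolding F_def using pb[OF u]
      by (intro continuous_on_compose2[OF ch]) (auto simp: p_def intro!: continuous_intros)
    have "norm (F x - F y) \<le> \<epsilon>" if "\<bar>x - y\<bar> \<le> 2 * pi / real N" for x y
    proof -
      have "\<bar>sin \<beta> * u\<bar> \<le> 1"
        using u by (auto simp: abs_mult abs_le_iff intro!: mult_le_one)
      then have "dist (p u (\<beta> + x)) (p u (\<beta> + y)) \<le> 4 * \<bar>x - y\<bar>"
        using norm_rotated_point_diff_le[OF norm_e norm_w, of "cos \<beta>" "sin \<beta> * u" "\<beta> + x" "\<beta> + y"]
        by (simp add: p_def dist_norm)
      also have "\<dots> < \<delta>"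
        using that N(3) by simp
      finally show ?thesis
        using \<delta>[OF pb[OF u] pb[OF u]] by (simp add: F_def dist_norm)
    qed
    then have "norm (integral {0..2 * pi} F - (2 * pi / real N) *\<^sub>R S u) \<le> 2 * pi * \<epsilon>"
      unfolding S by (intro riemann_sum_bound cF N(1)) auto
    moreover have "integral {0..2 * pi} F = angular_integral h ((sin \<beta>)\<^sup>2 * (1 - u\<^sup>2))"
      unfolding F_def p_def
      by (rule angular_integral_rotated_point[OF ch]) (use y01[OF u] rad in auto)
    ultimately show ?thesis
      by simp
  qed
  have "integral {-1..1} (\<lambda>u. angular_integral h ((sin \<beta>)\<^sup>2 * (1 - u\<^sup>2)) - (2 * pi / real N) *\<^sub>R S u)
      = integral {-1..1} (\<lambda>u. angular_integral h ((sin \<beta>)\<^sup>2 * (1 - u\<^sup>2))) - (2 * pi / real N) *\<^sub>R integral {-1..1} S"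
    by (subst integral_diff) (auto intro!: integrable_continuous_real ca cS continuous_intros)
  \<comment> \<open>Integrating the pointwise error 2 pi \<epsilon> over an interval of length 2
    gives 4 pi \<epsilon>; the Riemann sums drop out because the integral of S is zero.\<close>
  moreover have "norm (integral {-1..1} (\<lambda>u. angular_integral h ((sin \<beta>)\<^sup>2 * (1 - u\<^sup>2))
      - (2 * pi / real N) *\<^sub>R S u)) \<le> 2 * pi * \<epsilon> * (1 - (- 1))"
    by (rule integral_bound) (use riemann in \<open>auto intro!: ca cS continuous_intros\<close>)
  ultimately show ?thesis
    using S0 by simp
qed

text \<open>The Abel integral J is continuous in x, and it is small at the squared sine of \<beta>
  for star polygons with many chords. Such angles converge to the arcsine of sqrt x, so J vanishes
  at x.\<close>

lemma abel_integral_angular_eq_0: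
  assumes ch: "continuous_on (cball 0 1) h"
    and zero: "\<And>N k \<beta>. 0 < N \<Longrightarrow> real N * \<beta> = pi * real k \<Longrightarrow> 0 < sin \<beta> \<Longrightarrow>
      ((\<lambda>t. h (star_ray e w \<beta> t)) has_integral 0) {0..real N * (2 * sin \<beta>)}"
    and x: "x \<in> {0..<1}"
  shows "integral {-1..1} (\<lambda>u. angular_integral h (x * (1 - u\<^sup>2))) = 0"
proof -
  define J where "J x = integral {-1..1} (\<lambda>u. angular_integral h (x * (1 - u\<^sup>2)))" for x
  have cJ: "continuous_on {0..1} J"
  proof -
    have r: "x * (1 - u\<^sup>2) \<in> {0..1}" if "x \<in> {0..1}" "u \<in> {-1..1}" for x u :: real
      using mult_one_minus_square_in_unit[of x u] that by auto
    have "continuous_on ({0..1} \<times> cbox (-1) 1) (\<lambda>(x, u). angular_integral h (x * (1 - u\<^sup>2)))"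
      unfolding split_beta
      by (intro continuous_on_compose2[OF continuous_on_angular_integral[OF ch]] continuous_intros)
        (use r in auto)
    then show ?thesis
      unfolding J_def using integral_continuous_on_param by fastforce
  qed
  define \<beta> where "\<beta> = arcsin (sqrt x)"
  have s: "0 \<le> sqrt x" "sqrt x < 1"
    using x by auto
  then have s': "- 1 \<le> sqrt x"
    by linarith
  have sin\<beta>: "(sin \<beta>)\<^sup>2 = x"
    unfolding \<beta>_def using s s' x by (subst sin_arcsin) auto
  have \<beta>0: "0 \<le> \<beta>"
    unfolding \<beta>_def using s arcsin_le_arcsin[of 0 "sqrt x"] by simp
  have \<beta>1: "\<beta> < pi / 2"
    unfolding \<beta>_def using s s' arcsin_less_arcsin[of "sqrt x" 1] by simp
  \<comment> \<open>Being odd, k is coprime to N = 2^m. It differs by at most 1 from \<beta> 2^m /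
    pi, so \<open>b m\<close> is within pi / 2^m of \<beta>; the summand 1 also keeps
    \<open>b m\<close> positive when \<beta> = 0.\<close>
  define k where "k m = 2 * nat \<lfloor>\<beta> * 2 ^ m / (2 * pi)\<rfloor> + 1" for m :: nat
  define b where "b m = pi * real (k m) / 2 ^ m" for m :: nat
  have bpos: "0 < b m" for m
    by (simp add: b_def k_def)
  have "norm (b m - \<beta>) \<le> pi * (1 / 2) ^ m" for m
  proof -
    define X where "X = \<beta> * 2 ^ m / (2 * pi)"
    have "0 \<le> X"
      using \<beta>0 by (simp add: X_def)
    then have "real (k m) = 2 * real_of_int \<lfloor>X\<rfloor> + 1"
      by (simp add: k_def X_def[symmetric])
    then have "\<bar>real (k m) - 2 * X\<bar> \<le> 1"
      by linarith
    then have "pi / 2 ^ m * \<bar>real (k m) - 2 * X\<bar> \<le> pi / 2 ^ m * 1"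
      by (intro mult_left_mono) auto
    moreover have "b m - \<beta> = pi / 2 ^ m * (real (k m) - 2 * X)"
      by (simp add: b_def X_def field_simps)
    ultimately show ?thesis
      by (simp add: abs_mult power_one_over)
  qed
  then have "eventually (\<lambda>m. norm (b m - \<beta>) \<le> pi * (1 / 2) ^ m) sequentially"
    by (intro always_eventually allI)
  moreover have "(\<lambda>m::nat. pi * (1 / 2) ^ m) \<longlonglongrightarrow> 0"
    by (intro tendsto_mult_right_zero LIMSEQ_realpow_zero) auto
  ultimately have "(\<lambda>m. b m - \<beta>) \<longlonglongrightarrow> 0"
    by (rule Lim_null_comparison)
  then have b: "b \<longlonglongrightarrow> \<beta>"
    by (rule LIM_zero_cancel)
  have "(\<lambda>m. (sin (b m))\<^sup>2) \<longlonglongrightarrow> (sin \<beta>)\<^sup>2"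
    by (intro tendsto_intros b)
  then have limJ: "(\<lambda>m. J ((sin (b m))\<^sup>2)) \<longlonglongrightarrow> J x"
    unfolding sin\<beta> by (rule continuous_on_tendsto_compose[OF cJ]) (use x in \<open>auto simp: abs_square_le_1\<close>)
  \<comment> \<open>As x < 1, the limit angle lies strictly below pi/2, so sin (b m) is eventually
    positive.\<close>
  have ev\<beta>: "eventually (\<lambda>m. b m < pi / 2) sequentially"
    using order_tendstoD(2)[OF b \<beta>1] .
  have "norm (J x) \<le> 4 * pi * \<epsilon>" if \<epsilon>: "0 < \<epsilon>" for \<epsilon>
  proof -
    obtain \<delta> where \<delta>: "0 < \<delta>" "\<And>x y. x \<in> cball 0 1 \<Longrightarrow> y \<in> cball 0 1 \<Longrightarrow> dist x y < \<delta> \<Longrightarrow> dist (h x) (h y) < \<epsilon>"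
      using compact_uniformly_continuous[OF ch compact_cball] \<epsilon>
      unfolding uniformly_continuous_on_def by metis
    have "(\<lambda>m. 8 * pi * (1 / 2) ^ m) \<longlonglongrightarrow> 0"
      by (intro tendsto_mult_right_zero LIMSEQ_realpow_zero) auto
    then have "eventually (\<lambda>m. 8 * pi * (1 / 2) ^ m < \<delta>) sequentially"
      using order_tendstoD(2) \<delta>(1) by blast
    with ev\<beta> have "eventually (\<lambda>m. norm (J ((sin (b m))\<^sup>2)) \<le> 4 * pi * \<epsilon>) sequentially"
    proof eventually_elim
      case (elim m)
      have sb: "0 < sin (b m)"
        using bpos[of m] elim(1) by (intro sin_gt_zero) auto
      have "real (2 ^ m) * b m = pi * real (k m)"
        by (simp add: b_def)
      then have "((\<lambda>t. h (star_ray e w (b m) t)) has_integral 0) {0..real (2 ^ m) * (2 * sin (b m))}"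
        by (intro zero sb) auto
      then show ?case
        unfolding J_def
        by (intro star_polygon_bound[OF ch, where \<delta> = \<delta> and N = "2 ^ m" and k = "k m"] sb)
          (use \<delta>(2) elim(2) in \<open>auto simp: b_def k_def power_one_over intro: less_imp_le\<close>)
    qed
    then show ?thesis
      using tendsto_upperbound[OF tendsto_norm[OF limJ]] by simp
  qed
  from this[of "\<epsilon> / (4 * pi)" for \<epsilon>] have "norm (J x) \<le> 0 + \<epsilon>" if "0 < \<epsilon>" for \<epsilon>
    using that by simp
  then have "norm (J x) \<le> 0"
    by (rule field_le_epsilon)
  then show ?thesis
    by (simp add: J_def)
qed

end

section \<open>Circle integrals in planes through e\<close>

text \<open>By linearity the difference h integrates to zero along all star rays, so the Abel
  transform of its angular integral vanishes. By injectivity the angular integral itself vanishes,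
  and up to the factor r this is the difference of the two circle integrals.\<close>

lemma circle_integral_diff_eq_0:
  fixes e w :: "'a::euclidean_space"
  assumes fr: "circle_frame C r e w" and r: "r \<le> 1"
    and cf: "continuous_on (cball 0 1) f" and cg: "continuous_on (cball 0 1) g"
    and T: "broken_ray_transform {e} f = broken_ray_transform {e} g"
  shows "circle_integral C f = circle_integral C g"
proof -
  interpret orthonormal_pair e w
    using fr by unfold_locales (auto simp: circle_frame_def)
  have r0: "0 < r"
    using fr by (simp add: circle_frame_def)
  define h where "h x = f x - g x" for x
  have ch: "continuous_on (cball 0 1) h"
    unfolding h_def by (intro continuous_intros cf cg)
  have "((\<lambda>t. h (star_ray e w \<beta> t)) has_integral 0) {0..real N * (2 * sin \<beta>)}"
    if "0 < N" "real N * \<beta> = pi * real k" "0 < sin \<beta>" for N k \<beta>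
  proof -
    note ray = star_ray_in_broken_rays[OF that(3,1,2)]
    \<comment> \<open>Membership of the star ray in \<open>broken_rays {e}\<close> makes the
      restricted function unfold to the integral, for f and g alike.\<close>
    have If: "((\<lambda>t. f (star_ray e w \<beta> t)) has_integral broken_ray_transform {e} f (real N * (2 * sin \<beta>), star_ray e w \<beta>))
        {0..real N * (2 * sin \<beta>)}" if "continuous_on (cball 0 1) f" for f :: "'a \<Rightarrow> complex"
      using star_ray_has_integral[OF that \<open>0 < sin \<beta>\<close>, of N] ray
      by (simp add: broken_ray_transform_def integral_unique)
    show ?thesis
      using has_integral_diff[OF If[OF cf] If[OF cg]] T by (simp add: h_def)
  qed
  then have "angular_integral h y = 0" if "y \<in> {0..<1}" for y
    using abel_injective[OF continuous_on_angular_integral[OF ch] abel_integral_angular_eq_0[OF ch] that]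
    by blast
  \<comment> \<open>From 0 < r \<le> 1 the argument lies in [0,1), the range of Abel injectivity;
    the unit circle corresponds to 0.\<close>
  then have "angular_integral h (1 - r\<^sup>2) = 0"
    using r r0 by (simp add: power_le_one)
  then have h0: "integral {0..2 * pi} (\<lambda>\<phi>. h (pt \<phi> r 0)) = 0"
    using r0 by (simp add: angular_integral_def)
  have C: "C \<subseteq> cball 0 1"
    using fr r by (auto simp: circle_frame_def circle_in_def)
  have i: "((\<lambda>\<phi>. f (pt \<phi> r 0)) integrable_on {0..2*pi})" if "continuous_on (cball 0 1) f" for f :: "'a \<Rightarrow> complex"
    using r r0 by (intro integrable_continuous_real continuous_on_compose2[OF that] continuous_intros)
      (auto simp: norm_rotated_point)
  have "integral {0..2 * pi} (\<lambda>\<phi>. f (pt \<phi> r 0)) = integral {0..2 * pi} (\<lambda>\<phi>. g (pt \<phi> r 0))"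
    using h0 integral_diff[OF i[OF cf] i[OF cg]] by (simp add: h_def)
  then show ?thesis
    by (simp add: circle_integral_eq[OF fr] continuous_on_subset[OF cf C] continuous_on_subset[OF cg C]
        circle_param_eq)
qed

text \<open>A quarter turn of e inside P supplies the second vector, and a comparison of dimensions
  identifies the span of the pair with P.\<close>

lemma circle_frame_extend:
  fixes e :: "'a::euclidean_space"
  assumes P: "subspace P" "dim P = 2" and e: "e \<in> P" "norm e = 1" and r: "0 < r"
  obtains w where "circle_frame (circle_in P r) r e w"
proof -
  \<comment> \<open>A frame identifies circles rather than planes; with radius 1 the common circle
    contains e, u and v themselves.\<close>
  obtain u v where "circle_frame (circle_in P 1) 1 u v"
    using circle_frame_exists[OF P zero_less_one] by blast
  then have uv: "norm u = 1" "norm v = 1" "u \<bullet> v = 0" and eq: "circle_in P 1 = circle_in (span {u, v}) 1"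
    by (auto simp: circle_frame_def)
  interpret orthonormal_pair u v
    by unfold_locales (fact uv)+
  have "e \<in> span {u, v}"
    using e eq by (auto simp: circle_in_def)
  then obtain a b where ab: "e = a *\<^sub>R u + b *\<^sub>R v"
    using in_span_pair by blast
  then have e_pt: "e = pt 0 a b"
    by (simp add: rotated_point_def)
  define w where "w = pt 0 (- b) a"
  have n1: "a\<^sup>2 + b\<^sup>2 = 1"
    using e(2) norm_rotated_point[of 0 a b] e_pt by simp
  then have w: "norm w = 1" "e \<bullet> w = 0"
    using norm_rotated_point[of 0 "-b" a] by (auto simp: w_def e_pt inner_rotated_point add.commute)
  have "u \<in> circle_in (span {u, v}) 1" "v \<in> circle_in (span {u, v}) 1"
    using uv by (auto simp: circle_in_def span_base)
  then have "u \<in> P" "v \<in> P"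
    unfolding eq[symmetric] by (auto simp: circle_in_def)
  then have wP: "w \<in> P"
    unfolding w_def rotated_point_def by (intro subspace_add[OF P(1)] subspace_scale[OF P(1)])
  have "independent {e, w}"
    using e(2) w by (intro pairwise_orthogonal_independent) (auto simp: pairwise_insert orthogonal_def inner_commute)
  moreover have "e \<noteq> w"
    using w(2) e(2) by (auto simp: norm_eq_1)
  ultimately have "span {e, w} = P"
    using e(1) wP P by (intro subspace_dim_equal) (auto simp: dim_eq_card_independent span_minimal)
  then show ?thesis
    using that[of w] e(2) w r by (simp add: circle_frame_def)
qed

theorem theorem3:
  fixes e :: "real ^ 'n" and f g :: "real ^ 'n \<Rightarrow> complex"
  assumes "CARD('n) \<ge> 2"
    and "e \<in> sphere 0 1"
    and "continuous_on (cball 0 1) f"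
    and "continuous_on (cball 0 1) g"
    and "broken_ray_transform {e} f = broken_ray_transform {e} g"
  shows "(\<forall>P r. subspace P \<and> dim P = 2 \<and> e \<in> P \<and> 0 < r \<and> circle_in P r \<subseteq> cball 0 1 \<longrightarrow>
            circle_integral (circle_in P r) f = circle_integral (circle_in P r) g) \<and>
         (CARD('n) = 2 \<longrightarrow>
           (\<forall>r. 0 < r \<and> sphere 0 r \<subseteq> (cball 0 1 :: (real ^ 'n) set) \<longrightarrow>
             circle_integral (sphere 0 r) f = circle_integral (sphere 0 r) g))"
proof -
  have main: "circle_integral (circle_in P r) f = circle_integral (circle_in P r) g"
    if P: "subspace P" "dim P = 2" "e \<in> P" and r: "0 < r" "circle_in P r \<subseteq> cball 0 1" for P r
  proof -
    have e: "norm e = 1"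
      using assms(2) by simp
    \<comment> \<open>This point of the circle turns the inclusion in the ball into r \<le>
      1.\<close>
    have "r *\<^sub>R e \<in> circle_in P r"
      using P r(1) e by (simp add: circle_in_def subspace_scale)
    then have "r *\<^sub>R e \<in> cball 0 1"
      using r(2) by blast
    then have "r \<le> 1"
      using r(1) e by simp
    then show ?thesis
      using circle_frame_extend[OF P(1,2,3) e r(1)] circle_integral_diff_eq_0 assms(3-5) by metis
  qed
  moreover have "circle_integral (sphere 0 r) f = circle_integral (sphere 0 r) g"
    if "CARD('n) = 2" "0 < r" "sphere 0 r \<subseteq> (cball 0 1 :: (real ^ 'n) set)" for r
  proof -
    \<comment> \<open>In dimension two the whole space is the plane through e.\<close>
    have "sphere 0 r = circle_in (UNIV :: (real ^ 'n) set) r"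
      by (auto simp: circle_in_def)
    then show ?thesis
      using main[of UNIV r] that by simp
  qed
  ultimately show ?thesis
    by blast
qed

end
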